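(* Let $\pi:X\to Y$ be a finite-to-one factor code from a shift of finite type $X$ to an irreducible sofic shift $Y$. Then $c_\pi=d_\pi$, i.e. the class degree of $\pi$ equals the degree of $\pi$.
   Context: All shift spaces are one-dimensional, two-sided, over finite alphabets. A factor code is a surjective continuous shift-commuting map; it is finite-to-one if each point of $Y$ has finitely many preimages (there is then a uniform upper bound on the number of preimages). The degree of a finite-to-one factor code is $d_\pi=\min_{y\in Y}|\pi^{-1}(y)|$. For $x,x'\in X$ write $x\to x'$ if for each integer $n$ there is $v\in X$ with $\pi(v)=\pi(x)=\pi(x')$, $v_j=x_j$ for all $j\le n$, and, for some $i\ge n$, $v_j=x'_j$ for all $j\ge i$. Write $x\sim x'$ if $x\to x'$ and $x'\to x$; this is an equivalence relation whose classes are called transition classes. $\mathscr{C}_\pi(y)$ is the set of transition classes contained in $\pi^{-1}(y)$. The class degree is $c_\pi=\min_{y\in Y}|\mathscr{C}_\pi(y)|$. *)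

theory Defs
  imports "HOL-Analysis.Function_Topology" "HOL-Library.Extended_Nat"
begin

definition full_shift_topology :: "'a set \<Rightarrow> (int \<Rightarrow> 'a) topology" where
  "full_shift_topology A = product_topology (\<lambda>_. discrete_topology A) UNIV"

definition shift_map :: "(int \<Rightarrow> 'a) \<Rightarrow> (int \<Rightarrow> 'a)" where
  "shift_map x = (\<lambda>i. x (i + 1))"

definition shift_space :: "'a set \<Rightarrow> (int \<Rightarrow> 'a) set \<Rightarrow> bool" where
  "shift_space A X \<longleftrightarrow> finite A \<and> closedin (full_shift_topology A) X \<and> shift_map ` X = X"

definition block :: "(int \<Rightarrow> 'a) \<Rightarrow> int \<Rightarrow> nat \<Rightarrow> 'a list" where
  "block x i n = map (\<lambda>k. x (i + int k)) [0..<n]"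

definition language :: "(int \<Rightarrow> 'a) set \<Rightarrow> 'a list set" where
  "language X = {block x i n | x i n. x \<in> X}"

definition shift_of_finite_type :: "'a set \<Rightarrow> (int \<Rightarrow> 'a) set \<Rightarrow> bool" where
  "shift_of_finite_type A X \<longleftrightarrow> finite A \<and>
     (\<exists>F. finite F \<and> X = {x. range x \<subseteq> A \<and> (\<forall>i n. block x i n \<notin> F)})"

definition irreducible_shift :: "(int \<Rightarrow> 'a) set \<Rightarrow> bool" where
  "irreducible_shift X \<longleftrightarrow>
     (\<forall>u\<in>language X. \<forall>w\<in>language X. \<exists>v. u @ v @ w \<in> language X)"

definition factor_code ::
  "'a set \<Rightarrow> (int \<Rightarrow> 'a) set \<Rightarrow> 'b set \<Rightarrow> (int \<Rightarrow> 'b) set \<Rightarrow> ((int \<Rightarrow> 'a) \<Rightarrow> (int \<Rightarrow> 'b)) \<Rightarrow> bool"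
where
  "factor_code A X B Y \<pi> \<longleftrightarrow>
     shift_space A X \<and> shift_space B Y \<and>
     continuous_map (subtopology (full_shift_topology A) X)
                    (subtopology (full_shift_topology B) Y) \<pi> \<and>
     \<pi> ` X = Y \<and> (\<forall>x\<in>X. \<pi> (shift_map x) = shift_map (\<pi> x))"

text \<open>A sofic shift is a factor of a shift of finite type. HOL cannot quantify over the type
  of the symbols of the cover; since every finite alphabet can be renamed to a finite set of
  natural numbers, taking those as the alphabets of the covers loses no generality.\<close>

definition sofic_shift :: "'b set \<Rightarrow> (int \<Rightarrow> 'b) set \<Rightarrow> bool" where
  "sofic_shift B Y \<longleftrightarrow>
     (\<exists>(C :: nat set) Z \<phi>. shift_of_finite_type C Z \<and> factor_code C Z B Y \<phi>)"

text \<open>Maps between shift spaces are total functions in HOL, of which only the values on \<open>X\<close>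
  matter; hence fibres are intersected with \<open>X\<close>.\<close>

definition fibre :: "(int \<Rightarrow> 'a) set \<Rightarrow> ((int \<Rightarrow> 'a) \<Rightarrow> (int \<Rightarrow> 'b)) \<Rightarrow> (int \<Rightarrow> 'b) \<Rightarrow> (int \<Rightarrow> 'a) set"
where
  "fibre X \<pi> y = {x \<in> X. \<pi> x = y}"

definition finite_to_one ::
  "(int \<Rightarrow> 'a) set \<Rightarrow> (int \<Rightarrow> 'b) set \<Rightarrow> ((int \<Rightarrow> 'a) \<Rightarrow> (int \<Rightarrow> 'b)) \<Rightarrow> bool" where
  "finite_to_one X Y \<pi> \<longleftrightarrow> (\<forall>y\<in>Y. finite (fibre X \<pi> y))"

text \<open>Unlike \<^const>\<open>card\<close>, this does not send infinite sets to 0, which would spoil the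
  minima below.\<close>

definition ecard :: "'a set \<Rightarrow> enat" where
  "ecard S = (if finite S then enat (card S) else \<infinity>)"

text \<open>As \<^typ>\<open>enat\<close> is well-ordered, the infimum over a nonempty index set is attained,
  that is, a minimum.\<close>

definition code_degree ::
  "(int \<Rightarrow> 'a) set \<Rightarrow> (int \<Rightarrow> 'b) set \<Rightarrow> ((int \<Rightarrow> 'a) \<Rightarrow> (int \<Rightarrow> 'b)) \<Rightarrow> enat" where
  "code_degree X Y \<pi> = (INF y\<in>Y. ecard (fibre X \<pi> y))"

definition transition ::
  "(int \<Rightarrow> 'a) set \<Rightarrow> ((int \<Rightarrow> 'a) \<Rightarrow> (int \<Rightarrow> 'b)) \<Rightarrow> (int \<Rightarrow> 'a) \<Rightarrow> (int \<Rightarrow> 'a) \<Rightarrow> bool" where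
  "transition X \<pi> x x' \<longleftrightarrow>
     (\<forall>n. \<exists>v\<in>X. \<pi> v = \<pi> x \<and> \<pi> x = \<pi> x' \<and> (\<forall>j\<le>n. v j = x j) \<and>
        (\<exists>i\<ge>n. \<forall>j\<ge>i. v j = x' j))"

definition transition_equiv ::
  "(int \<Rightarrow> 'a) set \<Rightarrow> ((int \<Rightarrow> 'a) \<Rightarrow> (int \<Rightarrow> 'b)) \<Rightarrow> ((int \<Rightarrow> 'a) \<times> (int \<Rightarrow> 'a)) set" where
  "transition_equiv X \<pi> =
     {(x, x'). x \<in> X \<and> x' \<in> X \<and> transition X \<pi> x x' \<and> transition X \<pi> x' x}"

definition transition_classes ::
  "(int \<Rightarrow> 'a) set \<Rightarrow> ((int \<Rightarrow> 'a) \<Rightarrow> (int \<Rightarrow> 'b)) \<Rightarrow> (int \<Rightarrow> 'b) \<Rightarrow> (int \<Rightarrow> 'a) set set" where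
  "transition_classes X \<pi> y = {C \<in> X // transition_equiv X \<pi>. C \<subseteq> fibre X \<pi> y}"

definition class_degree ::
  "(int \<Rightarrow> 'a) set \<Rightarrow> (int \<Rightarrow> 'b) set \<Rightarrow> ((int \<Rightarrow> 'a) \<Rightarrow> (int \<Rightarrow> 'b)) \<Rightarrow> enat" where
  "class_degree X Y \<pi> = (INF y\<in>Y. ecard (transition_classes X \<pi> y))"

end

theory Submission imports Defs begin

text \<open>
  A fibre splits into its transition classes, so it has at least as many points as classes, and
  \<open>c\<^sub>\<pi> \<le> d\<^sub>\<pi>\<close> is immediate. For the converse it suffices to find, for every \<open>y\<^sub>0 \<in> Y\<close>, a point
  \<open>y \<in> Y\<close> whose fibre has at most as many points as \<open>y\<^sub>0\<close> has transition classes (\<open>small_fibre\<close>).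

  Choose a representative of each class over \<open>y\<^sub>0\<close>. As the fibre of \<open>y\<^sub>0\<close> is finite, there is one
  time \<open>t\<close> and one time \<open>T \<ge> t\<close> such that every point of the fibre can leave its course after
  time \<open>0\<close>, follow its representative around time \<open>t\<close>, and be back on its course from time \<open>T\<close> on,
  without changing its image (\<open>detour_in_fibre\<close>). By compactness, a long enough central block \<open>w\<close>
  of \<open>y\<^sub>0\<close> forces every \<open>x \<in> X\<close> whose image shows \<open>w\<close> to look like a point of that fibre on the
  times involved, so that \<open>x\<close> can make the same detour (\<open>transition_word\<close>). The number of blocks
  used around time \<open>t\<close> is at most the number of classes over \<open>y\<^sub>0\<close>.

  Irreducibility of \<open>Y\<close> yields a periodic point \<open>y \<in> Y\<close> that contains \<open>w\<close>
  (\<open>periodic_point_through_block\<close>). Its fibre is finite and invariant under a power of the shift,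
  so it consists of periodic points (\<open>periodic_in_fibre\<close>). Suppose that the detours of two points
  \<open>x, x'\<close> of this fibre run through the same block. Joining the first half of one detour to the
  second half of the other gives a point of the fibre that equals \<open>x\<close> far to the left and \<open>x'\<close>
  far to the right. Periodic points that agree on a ray are equal, so \<open>x = x'\<close>. Hence the fibre
  of \<open>y\<close> has at most as many points as there are blocks.
\<close>

section \<open>Compactness\<close>

text \<open>Sequential compactness of the two-sided full shift. A nested sequence of infinite index sets
  is chosen so that on the \<open>L\<close>-th one all points agree on the central window of radius \<open>L\<close>;
  the limit is read off along this sequence.\<close>

lemma cluster_point:
  fixes x :: "nat \<Rightarrow> int \<Rightarrow> 'a"
  assumes "finite A" and "\<And>n j. x n j \<in> A"
  obtains z where "\<And>L. \<exists>n. L \<le> int n \<and> (\<forall>j\<in>{-L..L}. x n j = z j)"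
proof -
  define agree where "agree L S \<longleftrightarrow> infinite S \<and>
    (\<forall>m\<in>S. \<forall>n\<in>S. \<forall>j\<in>{-int L..int L}. x m j = x n j)" for L S
  have refine: "\<exists>S\<subseteq>T. agree L S" if T: "infinite T" for T L
  proof -
    define f where "f n = map (x n) [-int L..int L]" for n
    have "f ` T \<subseteq> {xs. set xs \<subseteq> A \<and> length xs = length [-int L..int L]}"
      using assms(2) by (auto simp: f_def)
    then have "finite (f ` T)"
      using finite_lists_length_eq[OF assms(1)] by (rule finite_subset)
    then obtain a where a: "a \<in> T" "infinite {n \<in> T. f n = f a}"
      using pigeonhole_infinite[OF T] by blast
    have "x m j = x n j" if "f m = f a" "f n = f a" "j \<in> {-int L..int L}" for m n j
    proof -
      have "map (x m) [-int L..int L] = map (x n) [-int L..int L]"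
        using that by (simp add: f_def)
      then have "\<forall>i\<in>set [-int L..int L]. x m i = x n i" by (rule iffD1[OF map_eq_conv])
      then show ?thesis using that(3) unfolding set_upto by (rule bspec)
    qed
    then have "agree L {n \<in> T. f n = f a}" using a(2) unfolding agree_def by blast
    moreover have "{n \<in> T. f n = f a} \<subseteq> T" by blast
    ultimately show ?thesis by blast
  qed
  have "\<exists>S. \<forall>L. agree L (S L) \<and> S (Suc L) \<subseteq> S L"
  proof (rule dependent_nat_choice)
    show "\<exists>S. agree 0 S" using refine[of UNIV 0] by auto
    show "\<exists>S'. agree (Suc L) S' \<and> S' \<subseteq> S" if "agree L S" for S L
      using that refine[of S "Suc L"] by (auto simp: agree_def)
  qed
  then obtain S where S: "\<And>L. agree L (S L)" "\<And>L. S (Suc L) \<subseteq> S L" by blast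
  have mono: "S m \<subseteq> S l" if "l \<le> m" for l m
    using that S(2) by (rule lift_Suc_antimono_le[rotated])
  define z where "z j = x (SOME n. n \<in> S (nat \<bar>j\<bar>)) j" for j
  have "\<exists>n. L \<le> int n \<and> (\<forall>j\<in>{-L..L}. x n j = z j)" for L
  proof -
    have "infinite (S (nat L))" using S(1) by (simp add: agree_def)
    then obtain n where n: "n \<in> S (nat L)" "nat L \<le> n"
      using infinite_nat_iff_unbounded_le by blast
    have "x n j = z j" if j: "j \<in> {-L..L}" for j
    proof -
      have "nat \<bar>j\<bar> \<le> nat L" using j by (intro nat_mono) (simp add: abs_le_iff)
      then have "n \<in> S (nat \<bar>j\<bar>)" using n(1) mono by blast
      moreover from this have "(SOME n. n \<in> S (nat \<bar>j\<bar>)) \<in> S (nat \<bar>j\<bar>)" by (rule someI)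
      moreover have "j \<in> {-int (nat \<bar>j\<bar>)..int (nat \<bar>j\<bar>)}" by auto
      ultimately show ?thesis using S(1)[of "nat \<bar>j\<bar>"] unfolding agree_def z_def by blast
    qed
    then show ?thesis using n(2) by (intro exI[of _ n]) auto
  qed
  then show ?thesis using that by blast
qed

section \<open>Codes on shifts of finite type are local\<close>

text \<open>Continuity and the finite list of forbidden blocks enter the argument only through one common
  radius \<open>r\<close>: membership in \<open>X\<close> is decided by the windows of radius \<open>r\<close>, and so is every
  coordinate of the image. With one radius for both, a single overlap length suffices to splice
  points and to control the image of the result.\<close>

locale local_code =
  fixes A :: "'a set" and X :: "(int \<Rightarrow> 'a) set" and \<pi> :: "(int \<Rightarrow> 'a) \<Rightarrow> (int \<Rightarrow> 'b)"
    and r :: int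
  assumes finite_alphabet: "finite A"
    and in_alphabet: "x \<in> X \<Longrightarrow> x j \<in> A"
    and radius_nonneg: "0 \<le> r"
    and locally_in: "(\<And>k. \<exists>x\<in>X. \<forall>j\<in>{k-r..k+r}. z j = x j) \<Longrightarrow> z \<in> X"
    and code_local: "\<lbrakk>x \<in> X; x' \<in> X; \<And>j. j \<in> {k-r..k+r} \<Longrightarrow> x j = x' j\<rbrakk> \<Longrightarrow> \<pi> x k = \<pi> x' k"
    and translate_in: "x \<in> X \<Longrightarrow> (\<lambda>j. x (j + p)) \<in> X"
    and code_translate: "x \<in> X \<Longrightarrow> \<pi> (\<lambda>j. x (j + p)) = (\<lambda>j. \<pi> x (j + p))"

lemma sft_translate:
  assumes "shift_of_finite_type A X" "x \<in> X"
  shows "(\<lambda>j. x (j + p)) \<in> X"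
proof -
  obtain F where F: "X = {x. range x \<subseteq> A \<and> (\<forall>i n. block x i n \<notin> F)}"
    using assms(1) unfolding shift_of_finite_type_def by blast
  have "block (\<lambda>j. x (j + p)) i n = block x (i + p) n" for i n
    by (simp add: block_def algebra_simps)
  then show ?thesis using assms(2) unfolding F by auto
qed

text \<open>A point whose windows all occur in points of \<open>X\<close> avoids the forbidden blocks once the windows
  are at least as long as these.\<close>

lemma sft_locally_determined:
  assumes "shift_of_finite_type A X"
  obtains m where "0 \<le> m"
    "\<And>z. (\<And>k. \<exists>x\<in>X. \<forall>j\<in>{k-m..k+m}. z j = x j) \<Longrightarrow> z \<in> X"
proof -
  obtain F where F: "finite F" "X = {x. range x \<subseteq> A \<and> (\<forall>i n. block x i n \<notin> F)}"
    using assms unfolding shift_of_finite_type_def by blast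
  obtain l where l: "\<And>f. f \<in> F \<Longrightarrow> length f \<le> l"
    using finite_nat_set_iff_bounded_le[of "length ` F"] F(1) by auto
  have "z \<in> X" if z: "\<And>k. \<exists>x\<in>X. \<forall>j\<in>{k-int l..k+int l}. z j = x j" for z
  proof -
    have "z k \<in> A" for k using z[of k] F(2) by force
    moreover have "block z i n \<notin> F" for i n
    proof
      assume b: "block z i n \<in> F"
      then have n: "n \<le> l" using l[OF b] by (simp add: block_def)
      obtain x where x: "x \<in> X" "\<forall>j\<in>{i-int l..i+int l}. z j = x j" using z by blast
      have "block z i n = block x i n" using x(2) n by (simp add: block_def)
      then show False using b x(1) F(2) by simp
    qed
    ultimately show ?thesis unfolding F(2) by auto
  qed
  then show ?thesis using that[of "int l"] by simp
qed

text \<open>A basic open set of the product topology restricts finitely many coordinates, so a neighbourhood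
  of \<open>z\<close> on which the clopen condition on the image holds contains a central cylinder.\<close>

lemma continuous_coordinate:
  assumes "continuous_map (subtopology (full_shift_topology A) X)
             (subtopology (full_shift_topology B) Y) \<pi>"
    and "\<And>x j. x \<in> X \<Longrightarrow> x j \<in> A" and "z \<in> X"
  shows "\<exists>L. \<forall>x\<in>X. (\<forall>j\<in>{-L..L}. x j = z j) \<longrightarrow> \<pi> x 0 = \<pi> z 0"
proof -
  let ?T = "subtopology (full_shift_topology A) X"
  have sub: "X \<subseteq> topspace (full_shift_topology A)"
    using assms(2) by (auto simp: full_shift_topology_def)
  then have top: "topspace ?T = X" by auto
  have "continuous_map ?T (full_shift_topology B) \<pi>"
    using assms(1) continuous_map_in_subtopology by blast
  then have cont: "continuous_map ?T (discrete_topology B) (\<lambda>x. \<pi> x 0)"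
    unfolding full_shift_topology_def
    by (simp add: continuous_map_componentwise_UNIV)
  then have "\<pi> z 0 \<in> B" using assms(3) top
    by (metis continuous_map_image_subset_topspace image_subset_iff topspace_discrete_topology)
  then have "openin ?T {x \<in> topspace ?T. \<pi> x 0 \<in> {\<pi> z 0}}"
    using openin_continuous_map_preimage[OF cont, of "{\<pi> z 0}"] by simp
  then obtain V where V: "openin (full_shift_topology A) V" 
      "{x \<in> X. \<pi> x 0 = \<pi> z 0} = V \<inter> X"
    unfolding openin_subtopology top by auto
  have "z \<in> V" using V(2) assms(3) by blast
  then obtain U where U: "finite {i. U i \<noteq> A}" "z \<in> Pi\<^sub>E UNIV U" "Pi\<^sub>E UNIV U \<subseteq> V"
    using V(1) unfolding full_shift_topology_def openin_product_topology_alt by force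
  obtain l where l: "\<And>i. U i \<noteq> A \<Longrightarrow> nat \<bar>i\<bar> \<le> l"
    using finite_nat_set_iff_bounded_le[of "(\<lambda>i. nat \<bar>i\<bar>) ` {i. U i \<noteq> A}"] U(1) by auto
  have "\<pi> x 0 = \<pi> z 0" if x: "x \<in> X" "\<forall>j\<in>{-int l..int l}. x j = z j" for x
  proof -
    have "x i \<in> U i" for i
    proof (cases "U i = A")
      case False
      then have "i \<in> {-int l..int l}" using l[of i] by auto
      then have "x i = z i" using x(2) by blast
      then show ?thesis using U(2) by auto
    qed (use assms(2) x(1) in auto)
    then have "x \<in> V" using U(3) by auto
    then show ?thesis using V(2) x(1) by blast
  qed
  then show ?thesis by blast
qed

text \<open>The Curtis-Hedlund-Lyndon theorem. Pairs of points that agree on ever larger windows while their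
  images differ at \<open>0\<close> would cluster at a point of \<open>X\<close> where continuity fails.\<close>

lemma local_code_exists:
  assumes sft: "shift_of_finite_type A X" and code: "factor_code A X B Y \<pi>"
  obtains r where "local_code A X \<pi> r"
proof -
  have fin: "finite A" and alph: "\<And>x j. x \<in> X \<Longrightarrow> x j \<in> A"
    using sft unfolding shift_of_finite_type_def by auto
  note tr = sft_translate[OF sft]
  have cont: "continuous_map (subtopology (full_shift_topology A) X)
                    (subtopology (full_shift_topology B) Y) \<pi>"
    and comm: "\<And>x. x \<in> X \<Longrightarrow> \<pi> (shift_map x) = shift_map (\<pi> x)"
    using code unfolding factor_code_def by auto
  have forward: "\<pi> (\<lambda>j. x (j + int n)) = (\<lambda>j. \<pi> x (j + int n))" if "x \<in> X" for x n
  proof (induction n)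
    case (Suc n)
    have "\<pi> (\<lambda>j. x (j + int (Suc n))) = \<pi> (shift_map (\<lambda>j. x (j + int n)))"
      by (simp add: shift_map_def algebra_simps)
    also have "\<dots> = shift_map (\<lambda>j. \<pi> x (j + int n))"
      using comm[OF tr[OF that]] Suc.IH by simp
    finally show ?case by (simp add: shift_map_def algebra_simps)
  qed simp
  have trans: "\<pi> (\<lambda>j. x (j + p)) = (\<lambda>j. \<pi> x (j + p))" if x: "x \<in> X" for x p
  proof (cases "0 \<le> p")
    case True
    then show ?thesis using forward[OF x, of "nat p"] by simp
  next
    case False
    have "\<pi> x = (\<lambda>j. \<pi> (\<lambda>j. x (j + p)) (j - p))"
      using forward[OF tr[OF x, of p], of "nat (-p)"] False by simp
    then have "\<pi> x (j + p) = \<pi> (\<lambda>j. x (j + p)) j" for j by (metis add_diff_cancel_right')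
    then show ?thesis by simp
  qed
  obtain m where m: "0 \<le> m" "\<And>z. (\<And>k. \<exists>x\<in>X. \<forall>j\<in>{k-m..k+m}. z j = x j) \<Longrightarrow> z \<in> X"
    using sft_locally_determined[OF sft] by blast
  have "\<exists>l::nat. \<forall>x\<in>X. \<forall>x'\<in>X. (\<forall>j\<in>{-int l..int l}. x j = x' j) \<longrightarrow> \<pi> x 0 = \<pi> x' 0"
  proof (rule ccontr)
    assume "\<not> ?thesis"
    then have "\<forall>l::nat. \<exists>x x'. x \<in> X \<and> x' \<in> X \<and> (\<forall>j\<in>{-int l..int l}. x j = x' j) \<and> \<pi> x 0 \<noteq> \<pi> x' 0"
      by blast
    then obtain x x' where x: "\<And>l. x l \<in> X" "\<And>l. x' l \<in> X"
        "\<And>l::nat. \<forall>j\<in>{-int l..int l}. x l j = x' l j" "\<And>l. \<pi> (x l) 0 \<noteq> \<pi> (x' l) 0"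
      by metis
    obtain z where z: "\<And>L. \<exists>n. L \<le> int n \<and> (\<forall>j\<in>{-L..L}. x n j = z j)"
      using cluster_point[of A x] fin alph x(1) by blast
    have "z \<in> X"
    proof (rule m(2))
      fix k
      obtain n where n: "\<forall>j\<in>{-(\<bar>k\<bar>+m)..\<bar>k\<bar>+m}. x n j = z j" using z by blast
      have "{k-m..k+m} \<subseteq> {-(\<bar>k\<bar>+m)..\<bar>k\<bar>+m}" by auto
      then have "\<forall>j\<in>{k-m..k+m}. z j = x n j" using n by (metis subsetD)
      then show "\<exists>x\<in>X. \<forall>j\<in>{k-m..k+m}. z j = x j" using x(1) by blast
    qed
    then obtain L where L: "\<forall>x\<in>X. (\<forall>j\<in>{-L..L}. x j = z j) \<longrightarrow> \<pi> x 0 = \<pi> z 0"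
      using continuous_coordinate[of A X B Y \<pi> z] cont alph by blast
    obtain n where n: "L \<le> int n" "\<forall>j\<in>{-L..L}. x n j = z j" using z by blast
    have "\<forall>j\<in>{-L..L}. x' n j = z j" using n x(3)[of n] by auto
    then show False using L n(2) x(1,2,4)[of n] by metis
  qed
  then obtain l :: nat where l: "\<And>x x'. \<lbrakk>x \<in> X; x' \<in> X; \<forall>j\<in>{-int l..int l}. x j = x' j\<rbrakk> \<Longrightarrow> \<pi> x 0 = \<pi> x' 0"
    by blast
  have "local_code A X \<pi> (max m (int l))"
  proof
    fix z assume z: "\<And>k. \<exists>x\<in>X. \<forall>j\<in>{k - max m (int l)..k + max m (int l)}. z j = x j"
    show "z \<in> X"
    proof (rule m(2))
      fix k
      obtain x where x: "x \<in> X" "\<forall>j\<in>{k - max m (int l)..k + max m (int l)}. z j = x j"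
        using z by blast
      have "{k-m..k+m} \<subseteq> {k - max m (int l)..k + max m (int l)}" by auto
      then have "\<forall>j\<in>{k-m..k+m}. z j = x j" using x(2) by (metis subsetD)
      then show "\<exists>x\<in>X. \<forall>j\<in>{k-m..k+m}. z j = x j" using x(1) by blast
    qed
  next
    fix x x' k assume x: "x \<in> X" "x' \<in> X"
      "\<And>j. j \<in> {k - max m (int l)..k + max m (int l)} \<Longrightarrow> x j = x' j"
    have "\<forall>j\<in>{-int l..int l}. x (j + k) = x' (j + k)"
    proof
      fix j assume "j \<in> {-int l..int l}"
      then have "j + k \<in> {k - max m (int l)..k + max m (int l)}" by auto
      then show "x (j + k) = x' (j + k)" by (rule x(3))
    qed
    then show "\<pi> x k = \<pi> x' k"
      using l[OF tr[OF x(1), of k] tr[OF x(2), of k]] trans x(1,2) by simp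
  qed (use fin alph tr trans m(1) in auto)
  then show ?thesis using that by blast
qed

section \<open>Splicing\<close>

definition splice :: "int \<Rightarrow> (int \<Rightarrow> 'a) \<Rightarrow> (int \<Rightarrow> 'a) \<Rightarrow> (int \<Rightarrow> 'a)" where
  "splice i x x' = (\<lambda>j. if j < i then x j else x' j)"

context local_code begin

text \<open>On an overlap of length \<open>2 * r\<close> centred at the junction, the window of radius \<open>r\<close> around any
  position lies entirely in one of the two points, on the side of the junction given by
  that position. Hence splicing stays in \<open>X\<close> and commutes with the code.\<close>

lemma splice_in:
  assumes "x \<in> X" "x' \<in> X" "\<And>j. j \<in> {i-r..<i+r} \<Longrightarrow> x j = x' j"
  shows "splice i x x' \<in> X"
proof (rule locally_in)
  fix k
  show "\<exists>u\<in>X. \<forall>j\<in>{k-r..k+r}. splice i x x' j = u j"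
  proof (cases "k < i")
    case True
    then have "\<forall>j\<in>{k-r..k+r}. splice i x x' j = x j"
      using assms(3) by (auto simp: splice_def)
    then show ?thesis using assms(1) by blast
  next
    case False
    then have "\<forall>j\<in>{k-r..k+r}. splice i x x' j = x' j"
      using assms(3) by (auto simp: splice_def)
    then show ?thesis using assms(2) by blast
  qed
qed

lemma code_splice:
  assumes "x \<in> X" "x' \<in> X" "\<And>j. j \<in> {i-r..<i+r} \<Longrightarrow> x j = x' j"
  shows "\<pi> (splice i x x') = splice i (\<pi> x) (\<pi> x')"
proof
  fix k
  have v: "splice i x x' \<in> X" using splice_in assms by blast
  show "\<pi> (splice i x x') k = splice i (\<pi> x) (\<pi> x') k"
  proof (cases "k < i")
    case True
    then have "splice i x x' j = x j" if "j \<in> {k-r..k+r}" for j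
      using assms(3)[of j] that by (auto simp: splice_def)
    then show ?thesis using code_local[OF v assms(1)] True by (simp add: splice_def)
  next
    case False
    then have "splice i x x' j = x' j" if "j \<in> {k-r..k+r}" for j
      using assms(3)[of j] that by (auto simp: splice_def)
    then show ?thesis using code_local[OF v assms(2)] False by (simp add: splice_def)
  qed
qed

text \<open>Compactness: if the image of \<open>x\<close> agrees with \<open>y\<close> on a large window, then \<open>x\<close> itself agrees with
  a true preimage of \<open>y\<close> on a prescribed window; otherwise counterexamples for growing windows
  would cluster at a preimage of \<open>y\<close> that they avoid.\<close>

lemma near_fibre:
  obtains L where "l \<le> L"
    "\<And>x. \<lbrakk>x \<in> X; \<And>j. j \<in> {-L..L} \<Longrightarrow> \<pi> x j = y j\<rbrakk> \<Longrightarrow>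
       \<exists>x'\<in>fibre X \<pi> y. \<forall>j\<in>{-l..l}. x j = x' j"
proof -
  have "\<exists>n. l \<le> int n \<and> (\<forall>x\<in>X. (\<forall>j\<in>{-int n..int n}. \<pi> x j = y j) \<longrightarrow>
       (\<exists>x'\<in>fibre X \<pi> y. \<forall>j\<in>{-l..l}. x j = x' j))"
  proof (rule ccontr)
    assume "\<not> ?thesis"
    then have far: "\<exists>x. x \<in> X \<and> (\<forall>j\<in>{-int n..int n}. \<pi> x j = y j) \<and>
       (\<forall>x'\<in>fibre X \<pi> y. \<exists>j\<in>{-l..l}. x j \<noteq> x' j)" if "l \<le> int n" for n
      using that by blast
    have "\<forall>n. \<exists>x. x \<in> X \<and> (\<forall>j\<in>{-int n..int n}. \<pi> x j = y j) \<and>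
       (\<forall>x'\<in>fibre X \<pi> y. \<exists>j\<in>{-l..l}. x j \<noteq> x' j)"
    proof
      fix n
      obtain x where x: "x \<in> X" "\<forall>j\<in>{-int (n + nat l)..int (n + nat l)}. \<pi> x j = y j"
        "\<forall>x'\<in>fibre X \<pi> y. \<exists>j\<in>{-l..l}. x j \<noteq> x' j"
      proof -
        have "l \<le> int (n + nat l)" by simp
        from far[OF this] show ?thesis using that by blast
      qed
      have "\<forall>j\<in>{-int n..int n}. \<pi> x j = y j" using x(2) by auto
      then show "\<exists>x. x \<in> X \<and> (\<forall>j\<in>{-int n..int n}. \<pi> x j = y j) \<and>
          (\<forall>x'\<in>fibre X \<pi> y. \<exists>j\<in>{-l..l}. x j \<noteq> x' j)"
        using x(1,3) by blast
    qed
    then obtain x where x: "\<And>n. x n \<in> X"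
      "\<And>n j. j \<in> {-int n..int n} \<Longrightarrow> \<pi> (x n) j = y j"
      "\<And>n x'. x' \<in> fibre X \<pi> y \<Longrightarrow> \<exists>j\<in>{-l..l}. x n j \<noteq> x' j"
      by metis
    obtain z where z: "\<And>L. \<exists>n. L \<le> int n \<and> (\<forall>j\<in>{-L..L}. x n j = z j)"
      using cluster_point[of A x] finite_alphabet in_alphabet x(1) by blast
    have window: "\<exists>n. \<bar>k\<bar> \<le> int n \<and> (\<forall>j\<in>{k-r..k+r}. z j = x n j)" for k
    proof -
      obtain n where n: "\<bar>k\<bar> + r \<le> int n" "\<forall>j\<in>{-(\<bar>k\<bar> + r)..\<bar>k\<bar> + r}. x n j = z j"
        using z by blast
      have "{k-r..k+r} \<subseteq> {-(\<bar>k\<bar>+r)..\<bar>k\<bar>+r}" by auto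
      then have "\<forall>j\<in>{k-r..k+r}. z j = x n j" using n(2) by (metis subsetD)
      then show ?thesis using n(1) radius_nonneg by (intro exI[of _ n]) auto
    qed
    have zX: "z \<in> X" by (rule locally_in) (use window x(1) in blast)
    have "\<pi> z k = y k" for k
    proof -
      obtain n where n: "\<bar>k\<bar> \<le> int n" "\<forall>j\<in>{k-r..k+r}. z j = x n j"
        using window by blast
      have "\<pi> z k = \<pi> (x n) k" using code_local[OF zX x(1)] n(2) by blast
      moreover have "k \<in> {-int n..int n}" using n(1) by (simp add: abs_le_iff)
      ultimately show ?thesis using x(2)[of k n] by simp
    qed
    then have "z \<in> fibre X \<pi> y" using zX by (auto simp: fibre_def)
    moreover obtain n where "\<forall>j\<in>{-l..l}. x n j = z j" using z by blast
    ultimately show False using x(3) by blast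
  qed
  then show ?thesis using that by blast
qed

end

section \<open>Transition classes and detours\<close>

lemma transition_class_self: "x \<in> X \<Longrightarrow> x \<in> transition_equiv X \<pi> `` {x}"
proof -
  assume x: "x \<in> X"
  have "\<exists>i\<ge>n. \<forall>j\<ge>i. x j = x j" for n :: int by (rule exI[of _ n]) simp
  then have "transition X \<pi> x x"
    unfolding transition_def using x by (intro allI bexI[of _ x] conjI refl impI)
  then show ?thesis using x by (simp add: transition_equiv_def)
qed

lemma transition_classes_eq_image:
  "transition_classes X \<pi> y = (\<lambda>x. transition_equiv X \<pi> `` {x}) ` fibre X \<pi> y"
proof (intro equalityI subsetI)
  fix C assume "C \<in> transition_classes X \<pi> y"
  then obtain x where "x \<in> X" "C = transition_equiv X \<pi> `` {x}" "C \<subseteq> fibre X \<pi> y"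
    unfolding transition_classes_def quotient_def by blast
  then show "C \<in> (\<lambda>x. transition_equiv X \<pi> `` {x}) ` fibre X \<pi> y"
    using transition_class_self[of x X \<pi>] by blast
next
  fix C assume "C \<in> (\<lambda>x. transition_equiv X \<pi> `` {x}) ` fibre X \<pi> y"
  then obtain x where x: "x \<in> fibre X \<pi> y" "C = transition_equiv X \<pi> `` {x}" by blast
  then have "C \<in> X // transition_equiv X \<pi>" by (auto simp: fibre_def intro: quotientI)
  moreover have "C \<subseteq> fibre X \<pi> y"
    using x by (auto simp: fibre_def transition_equiv_def transition_def)
  ultimately show "C \<in> transition_classes X \<pi> y" by (simp add: transition_classes_def)
qed

context local_code begin

text \<open>The relation \<open>x \<rightarrow> \<rho> x\<close> supplies the way out, \<open>\<rho> x \<rightarrow> x\<close> the way back, and the two are spliced at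
  time \<open>t\<close>, where both follow \<open>\<rho> x\<close>. The times can be chosen uniformly because
  the fibre is finite and every larger time does as well.\<close>

lemma detour_in_fibre:
  assumes fin: "finite (fibre X \<pi> y)"
    and equiv: "\<And>x. x \<in> fibre X \<pi> y \<Longrightarrow> (x, \<rho> x) \<in> transition_equiv X \<pi>"
  obtains t T where "0 < t" "t \<le> T"
    "\<And>x. x \<in> fibre X \<pi> y \<Longrightarrow> \<exists>u\<in>fibre X \<pi> y. (\<forall>j\<le>0. u j = x j) \<and>
       (\<forall>j\<in>{t-r..<t+r}. u j = \<rho> x j) \<and> (\<forall>j\<ge>T. u j = x j)"
proof -
  have "\<exists>i. \<forall>t\<ge>i. \<exists>v\<in>fibre X \<pi> y. (\<forall>j\<le>0. v j = x j) \<and> (\<forall>j\<ge>t-r. v j = \<rho> x j)"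
    if x: "x \<in> fibre X \<pi> y" for x
  proof -
    have "transition X \<pi> x (\<rho> x)" using equiv[OF x] by (simp add: transition_equiv_def)
    then obtain v where v: "v \<in> X" "\<pi> v = \<pi> x" "\<forall>j\<le>0. v j = x j" "\<exists>i\<ge>0. \<forall>j\<ge>i. v j = \<rho> x j"
      unfolding transition_def by blast
    then obtain i where i: "\<forall>j\<ge>i. v j = \<rho> x j" by blast
    have "v \<in> fibre X \<pi> y" using v(1,2) x by (simp add: fibre_def)
    then have "\<forall>t\<ge>i + r. \<exists>v\<in>fibre X \<pi> y. (\<forall>j\<le>0. v j = x j) \<and> (\<forall>j\<ge>t-r. v j = \<rho> x j)"
      using v(3) i by (intro allI impI bexI[of _ v]) auto
    then show ?thesis by blast
  qed
  then have "\<forall>x\<in>fibre X \<pi> y. \<forall>\<^sub>F t in at_top. 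
      \<exists>v\<in>fibre X \<pi> y. (\<forall>j\<le>0. v j = x j) \<and> (\<forall>j\<ge>t-r. v j = \<rho> x j)"
    unfolding eventually_at_top_linorder by blast
  then have "\<forall>\<^sub>F t in at_top. 0 < t \<and> (\<forall>x\<in>fibre X \<pi> y.  
      \<exists>v\<in>fibre X \<pi> y. (\<forall>j\<le>0. v j = x j) \<and> (\<forall>j\<ge>t-r. v j = \<rho> x j))"
    using eventually_ball_finite[OF fin] by (intro eventually_conj eventually_gt_at_top) 
  then obtain t where t: "0 < t" and out: "\<And>x. x \<in> fibre X \<pi> y \<Longrightarrow>
      \<exists>v\<in>fibre X \<pi> y. (\<forall>j\<le>0. v j = x j) \<and> (\<forall>j\<ge>t-r. v j = \<rho> x j)"
    using eventually_happens'[OF trivial_limit_at_top_linorder] by blast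
  define Q where "Q x T \<longleftrightarrow> (\<exists>u\<in>fibre X \<pi> y. (\<forall>j\<le>0. u j = x j) \<and>
       (\<forall>j\<in>{t-r..<t+r}. u j = \<rho> x j) \<and> (\<forall>j\<ge>T. u j = x j))" for x T
  have "\<exists>i. \<forall>T\<ge>i. Q x T" if x: "x \<in> fibre X \<pi> y" for x
  proof -
    obtain v where v: "v \<in> fibre X \<pi> y" "\<forall>j\<le>0. v j = x j" "\<forall>j\<ge>t-r. v j = \<rho> x j"
      using out[OF x] by blast
    have "transition X \<pi> (\<rho> x) x" using equiv[OF x] by (simp add: transition_equiv_def)
    then have "\<exists>v\<in>X. \<pi> v = \<pi> (\<rho> x) \<and> \<pi> (\<rho> x) = \<pi> x \<and> (\<forall>j\<le>t+r. v j = \<rho> x j) \<and>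
        (\<exists>i\<ge>t+r. \<forall>j\<ge>i. v j = x j)"
      unfolding transition_def by blast
    then obtain v' i where v': "v' \<in> X" "\<pi> v' = \<pi> x" "\<forall>j\<le>t+r. v' j = \<rho> x j"
        "i \<ge> t+r" "\<forall>j\<ge>i. v' j = x j" by auto
    let ?u = "splice t v v'"
    have agree: "v j = v' j" if "j \<in> {t-r..<t+r}" for j using v(3) v'(3) that by simp
    have "?u \<in> X" "\<pi> ?u = y"
      using splice_in[OF _ v'(1) agree] code_splice[OF _ v'(1) agree] v(1) v'(2) x
      by (auto simp: fibre_def splice_def)
    then have "?u \<in> fibre X \<pi> y" by (simp add: fibre_def)
    moreover have "\<forall>j\<le>0. ?u j = x j" using v(2) t by (auto simp: splice_def)
    moreover have "\<forall>j\<in>{t-r..<t+r}. ?u j = \<rho> x j" using v(3) v'(3) by (auto simp: splice_def)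
    moreover have "\<forall>j\<ge>i. ?u j = x j" using v'(4,5) radius_nonneg by (auto simp: splice_def)
    ultimately have "\<forall>T\<ge>i. Q x T" unfolding Q_def by (metis order_trans)
    then show ?thesis by blast
  qed
  then have "\<forall>x\<in>fibre X \<pi> y. \<forall>\<^sub>F T in at_top. Q x T"
    unfolding eventually_at_top_linorder by blast
  then have "\<forall>\<^sub>F T in at_top. t \<le> T \<and> (\<forall>x\<in>fibre X \<pi> y. Q x T)"
    using eventually_ball_finite[OF fin] by (intro eventually_conj eventually_ge_at_top)
  then obtain T where "t \<le> T" "\<And>x. x \<in> fibre X \<pi> y \<Longrightarrow> Q x T"
    using eventually_happens'[OF trivial_limit_at_top_linorder] by blast
  then show ?thesis using that t unfolding Q_def by blast
qed

text \<open>The central block of radius \<open>L\<close> of \<open>y\<close> is a transition block in the spirit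
  of Allahbakhshi and Quas: every point of \<open>X\<close> whose image shows it, at any position \<open>p\<close>, can be
  rerouted through one of few blocks of length \<open>2 * r\<close>. These are the blocks around time \<open>t\<close> of
  the points in \<open>R\<close>, one for each transition class over \<open>y\<close>.\<close>

lemma transition_word:
  assumes fin: "finite (fibre X \<pi> y)"
  obtains L t T R where "0 \<le> L" "0 < t" "t \<le> T" "finite R"
    "card R \<le> card (transition_classes X \<pi> y)"
    "\<And>x p. \<lbrakk>x \<in> X; \<And>j. j \<in> {-L..L} \<Longrightarrow> \<pi> x (p + j) = y j\<rbrakk> \<Longrightarrow>
       \<exists>\<rho>\<in>R. \<exists>u\<in>X. \<pi> u = \<pi> x \<and> (\<forall>j\<le>p. u j = x j) \<and>
         (\<forall>j\<in>{t-r..<t+r}. u (p + j) = \<rho> j) \<and> (\<forall>j\<ge>p+T. u j = x j)"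
proof -
  let ?cl = "\<lambda>x. transition_equiv X \<pi> `` {x}"
  define rep where "rep C = (SOME x. x \<in> C)" for C :: "(int \<Rightarrow> 'a) set"
  define R where "R = rep ` transition_classes X \<pi> y"
  have finc: "finite (transition_classes X \<pi> y)"
    using fin by (simp add: transition_classes_eq_image)
  have "(x, rep (?cl x)) \<in> transition_equiv X \<pi>" if "x \<in> fibre X \<pi> y" for x
  proof -
    have "x \<in> ?cl x" using that by (intro transition_class_self) (simp add: fibre_def)
    then have "rep (?cl x) \<in> ?cl x" unfolding rep_def by (rule someI[of "\<lambda>z. z \<in> ?cl x"])
    then show ?thesis by blast
  qed
  from detour_in_fibre[OF fin this] obtain t T where t: "0 < t" "t \<le> T" and
    detour: "\<And>x. x \<in> fibre X \<pi> y \<Longrightarrow> \<exists>u\<in>fibre X \<pi> y. (\<forall>j\<le>0. u j = x j) \<and>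
       (\<forall>j\<in>{t-r..<t+r}. u j = rep (?cl x) j) \<and> (\<forall>j\<ge>T. u j = x j)"
    by blast
  \<comment> \<open>Splicing at \<open>-r\<close> and at \<open>T + r\<close> needs agreement on all of \<open>{-2 * r..<T + 2 * r}\<close>.\<close>
  obtain L where L: "T + 2 * r \<le> L" and near:
    "\<And>x. \<lbrakk>x \<in> X; \<And>j. j \<in> {-L..L} \<Longrightarrow> \<pi> x j = y j\<rbrakk> \<Longrightarrow>
       \<exists>x'\<in>fibre X \<pi> y. \<forall>j\<in>{-(T+2*r)..T+2*r}. x j = x' j"
    using near_fibre[of "T + 2 * r" y] by blast
  have at_origin: "\<exists>\<rho>\<in>R. \<exists>u\<in>X. \<pi> u = \<pi> x \<and> (\<forall>j\<le>0. u j = x j) \<and>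
         (\<forall>j\<in>{t-r..<t+r}. u j = \<rho> j) \<and> (\<forall>j\<ge>T. u j = x j)"
    if x: "x \<in> X" "\<And>j. j \<in> {-L..L} \<Longrightarrow> \<pi> x j = y j" for x
  proof -
    obtain x' where x': "x' \<in> fibre X \<pi> y" "\<forall>j\<in>{-(T+2*r)..T+2*r}. x j = x' j"
      using near[OF x] by blast
    obtain u where u: "u \<in> fibre X \<pi> y" "\<forall>j\<le>0. u j = x' j"
       "\<forall>j\<in>{t-r..<t+r}. u j = rep (?cl x') j" "\<forall>j\<ge>T. u j = x' j"
      using detour[OF x'(1)] by blast
    have uX: "u \<in> X" "\<pi> u = y" using u(1) by (auto simp: fibre_def)
    let ?v = "splice (-r) x u"
    have 1: "x j = u j" if "j \<in> {-r-r..<-r+r}" for j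
      using that u(2) x'(2) t by auto
    have v: "?v \<in> X" "\<pi> ?v = splice (-r) (\<pi> x) y"
      using splice_in[OF x(1) uX(1) 1] code_splice[OF x(1) uX(1) 1] uX(2) by auto
    let ?w = "splice (T+r) ?v x"
    have 2: "?v j = x j" if "j \<in> {T+r-r..<T+r+r}" for j
      using that u(4) x'(2) t radius_nonneg by (auto simp: splice_def)
    have w: "?w \<in> X" "\<pi> ?w = splice (T+r) (splice (-r) (\<pi> x) y) (\<pi> x)"
      using splice_in[OF v(1) x(1) 2] code_splice[OF v(1) x(1) 2] v(2) by auto
    have "\<pi> ?w = \<pi> x"
      unfolding w(2) using x(2) L t radius_nonneg by (auto simp: splice_def fun_eq_iff)
    moreover have "?w j = x j" if "j \<le> 0" for j
    proof (cases "j < -r")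
      case False
      then have "x j = x' j" using that x'(2) t radius_nonneg by auto
      then show ?thesis using that u(2) by (simp add: splice_def)
    qed (use t radius_nonneg in \<open>simp add: splice_def\<close>)
    moreover have "?w j = rep (?cl x') j" if "j \<in> {t-r..<t+r}" for j
      using that u(3) t by (auto simp: splice_def)
    moreover have "?w j = x j" if "T \<le> j" for j
      using 2[of j] that by (auto simp: splice_def)
    moreover have "rep (?cl x') \<in> R"
      using x'(1) by (simp add: R_def transition_classes_eq_image)
    ultimately show ?thesis using w(1) by (intro bexI[of _ "rep (?cl x')"] bexI[of _ ?w]) auto
  qed
  have "\<exists>\<rho>\<in>R. \<exists>u\<in>X. \<pi> u = \<pi> x \<and> (\<forall>j\<le>p. u j = x j) \<and>
         (\<forall>j\<in>{t-r..<t+r}. u (p + j) = \<rho> j) \<and> (\<forall>j\<ge>p+T. u j = x j)"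
    if x: "x \<in> X" "\<And>j. j \<in> {-L..L} \<Longrightarrow> \<pi> x (p + j) = y j" for x p
  proof -
    have "\<pi> (\<lambda>j. x (j + p)) j = y j" if "j \<in> {-L..L}" for j
      using x that by (simp add: code_translate add.commute)
    from at_origin[OF translate_in[OF x(1)] this] obtain \<rho> u where u: "\<rho> \<in> R" "u \<in> X"
        "\<pi> u = (\<lambda>j. \<pi> x (j + p))" "\<forall>j\<le>0. u j = x (j + p)" "\<forall>j\<in>{t-r..<t+r}. u j = \<rho> j"
        "\<forall>j\<ge>T. u j = x (j + p)"
      using code_translate[OF x(1)] by auto
    let ?u = "\<lambda>j. u (j + -p)"
    have "?u \<in> X" "\<pi> ?u = \<pi> x"
      using translate_in[OF u(2), of "-p"] code_translate[OF u(2), of "-p"] u(3) by auto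
    then show ?thesis using u(1,4,5,6) by (intro bexI[of _ \<rho>] bexI[of _ ?u]) auto
  qed
  moreover have "0 \<le> L" using L t radius_nonneg by linarith
  moreover have "finite R" "card R \<le> card (transition_classes X \<pi> y)"
    using finc by (auto simp: R_def card_image_le)
  ultimately show ?thesis using that t by blast
qed

end

section \<open>Periodic points\<close>

lemma periodic_multiple:
  fixes x :: "int \<Rightarrow> 'a"
  assumes "\<And>j. x (j + s) = x j"
  shows "x (j + k * s) = x j"
proof (induction k rule: int_induct[of _ 0])
  case (step1 i)
  then show ?case using assms[of "j + i * s"] by (simp add: algebra_simps)
next
  case (step2 i)
  then show ?case using assms[of "j + (i - 1) * s"] by (simp add: algebra_simps)
qed simp

lemma periodic_eq_if_agree_on_ray:
  fixes x x' :: "int \<Rightarrow> 'a"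
  assumes "\<And>j. x (j + s) = x j" "0 < s" "\<And>j. x' (j + s') = x' j" "0 < s'"
    and "(\<forall>j\<ge>M. x j = x' j) \<or> (\<forall>j\<le>M. x j = x' j)"
  shows "x = x'"
proof
  fix j
  have per: "x (j + k * (s * s')) = x j" "x' (j + k * (s * s')) = x' j" for k
    using periodic_multiple[of x s j "k * s'"] periodic_multiple[of x' s' j "k * s"] assms(1,3)
    by (simp_all add: algebra_simps)
  have ss: "1 \<le> s * s'" using assms(2,4) by (simp add: int_one_le_iff_zero_less)
  have "\<bar>M - j\<bar> * 1 \<le> \<bar>M - j\<bar> * (s * s')" using ss by (intro mult_left_mono) auto
  then have "j + \<bar>M - j\<bar> * (s * s') \<ge> M" "j + (-\<bar>M - j\<bar>) * (s * s') \<le> M" by auto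
  then show "x j = x' j" using assms(5) per by metis
qed

text \<open>The nonempty word makes the start of the new occurrence differ from all previous ones.\<close>

lemma many_occurrences:
  assumes "irreducible_shift Y" "w \<in> language Y" "w \<noteq> []"
  shows "\<exists>W\<in>language Y. \<exists>S. finite S \<and> card S = K \<and>
    (\<forall>s\<in>S. s + length w \<le> length W \<and> take (length w) (drop s W) = w)"
proof (induction K)
  case 0
  then show ?case using assms(2) by (intro bexI[of _ w] exI[of _ "{}"]) auto
next
  case (Suc K)
  then obtain W S where W: "W \<in> language Y" "finite S" "card S = K"
    "\<forall>s\<in>S. s + length w \<le> length W \<and> take (length w) (drop s W) = w" by blast
  obtain v where v: "W @ v @ w \<in> language Y"
    using assms(1,2) W(1) unfolding irreducible_shift_def by blast
  let ?s = "length W + length v"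
  have "?s \<notin> S" using W(4) assms(3) by force
  then have "card (insert ?s S) = Suc K" using W(2,3) by simp
  then show ?case using W(2,4) 
    by (intro bexI[OF _ v] exI[of _ "insert ?s S"]) auto
qed

context local_code begin

text \<open>A preimage of a point of \<open>Y\<close> with more occurrences of the given block than there are words of
  the appropriate length over \<open>A\<close> shows the same word over two of them. This word overlaps
  the occurrence by \<open>r\<close> on both sides, so repeating the stretch between the two gives a
  periodic point of \<open>X\<close> whose image still contains the block.\<close>

lemma periodic_point_through_block:
  assumes irr: "irreducible_shift (\<pi> ` X)" and z: "z \<in> \<pi> ` X" and "0 \<le> L"
  obtains y q p where "y \<in> \<pi> ` X" "0 < q" "\<And>j. y (j + q) = y j"
    "\<And>j. j \<in> {-L..L} \<Longrightarrow> y (p + j) = z j"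
proof -
  define w where "w = block z (-L) (nat (2*L+1))"
  have w: "w \<in> language (\<pi> ` X)" "length w = nat (2*L+1)" "w \<noteq> []"
    using z \<open>0 \<le> L\<close> unfolding w_def language_def by (blast, simp_all add: block_def)
  define lists where "lists = {xs. set xs \<subseteq> A \<and> length xs = nat (2*L+2*r+1)}"
  have finl: "finite lists" unfolding lists_def by (rule finite_lists_length_eq[OF finite_alphabet])
  obtain W S where W: "W \<in> language (\<pi> ` X)" "finite S" "card S = Suc (card lists)"
    "\<And>s. s \<in> S \<Longrightarrow> s + length w \<le> length W \<and> take (length w) (drop s W) = w"
    using many_occurrences[OF irr w(1,3), of "Suc (card lists)"] by blast
  obtain x i l where x: "x \<in> X" "W = block (\<pi> x) i l"
    using W(1) by (auto simp: language_def)
  have occ: "\<pi> x (i + int s + L + j) = z j" if "s \<in> S" "j \<in> {-L..L}" for s j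
  proof -
    let ?k = "nat (L + j)"
    have k: "?k < length w" using that(2) w(2) by auto
    have "w ! ?k = take (length w) (drop s W) ! ?k" using W(4)[OF that(1)] by simp
    also have "\<dots> = drop s W ! ?k" using k by (rule nth_take)
    also have "\<dots> = W ! (s + ?k)" using W(4)[OF that(1)] by (intro nth_drop) linarith
    also have "\<dots> = \<pi> x (i + int (s + ?k))"
      using k W(4)[OF that(1)] x(2) by (simp add: block_def)
    finally have "w ! ?k = \<pi> x (i + int s + L + j)" using that(2) by (simp add: algebra_simps)
    moreover have "w ! ?k = z j" using k that(2) w(2) by (simp add: w_def block_def)
    ultimately show ?thesis by simp
  qed
  define f where "f s = map (\<lambda>k. x (i + int s - r + int k)) [0..<nat (2*L+2*r+1)]" for s
  have "f ` S \<subseteq> lists" using in_alphabet[OF x(1)] by (auto simp: f_def lists_def)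
  then have "card (f ` S) \<le> card lists" by (rule card_mono[OF finl])
  then have "card (f ` S) < card S" using W(3) by simp
  then have "\<not> inj_on f S" by (rule pigeonhole)
  then obtain s1 s2 where "s1 \<in> S" "s2 \<in> S" "f s1 = f s2" "s1 \<noteq> s2"
    unfolding inj_on_def by blast
  then obtain s s' where s: "s \<in> S" "f s = f s'" "s < s'"
    by (metis linorder_neqE_nat)
  define a where "a = i + int s - r"
  define q where "q = int s' - int s"
  have q: "0 < q" using s(3) by (simp add: q_def)
  have repeat: "x (a + d) = x (a + q + d)" if "0 \<le> d" "d \<le> 2*L+2*r" for d
  proof -
    have d: "nat d < nat (2*L+2*r+1)" using that by auto
    then have "f s ! nat d = x (a + d)" "f s' ! nat d = x (a + q + d)"
      using that by (simp_all add: f_def a_def q_def algebra_simps)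
    then show ?thesis using s(2) by simp
  qed
  define x' where "x' j = x (a + (j - a) mod q)" for j
  \<comment> \<open>The repeated word may be longer than the period, so the equality is pushed along it.\<close>
  have unroll: "0 \<le> d \<Longrightarrow> d \<le> q + 2*L + 2*r \<Longrightarrow> x (a + d mod q) = x (a + d)" for d
  proof (induction "nat d" arbitrary: d rule: less_induct)
    case less
    show ?case
    proof (cases "d < q")
      case False
      then have "x (a + (d - q) mod q) = x (a + (d - q))"
        using less.hyps[of "d - q"] less.prems q by auto
      also have "\<dots> = x (a + d)" using repeat[of "d - q"] less.prems False by (simp add: algebra_simps)
      finally show ?thesis by simp
    qed (use less.prems in simp)
  qed
  have period: "x' (j + q) = x' j" for j
  proof -
    have "(j + q - a) mod q = (j - a + q) mod q" by (simp add: algebra_simps)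
    then show ?thesis by (simp add: x'_def)
  qed
  have x'X: "x' \<in> X"
  proof (rule locally_in)
    fix k
    define e where "e = (k - r - a) mod q"
    have e: "0 \<le> e" "e < q" using q by (auto simp: e_def)
    let ?p = "a + e - (k - r)"
    have "x' j = x (j + ?p)" if "j \<in> {k-r..k+r}" for j
    proof -
      have "(j - a) mod q = (e + (j - (k - r))) mod q"
        unfolding e_def mod_add_left_eq by (simp add: algebra_simps)
      then have "x' j = x (a + (e + (j - (k - r))) mod q)" by (simp add: x'_def)
      also have "\<dots> = x (a + (e + (j - (k - r))))"
        using that e \<open>0 \<le> L\<close> by (intro unroll) auto
      finally show ?thesis by (simp add: algebra_simps)
    qed
    then show "\<exists>x\<in>X. \<forall>j\<in>{k-r..k+r}. x' j = x j"
      by (intro bexI[OF _ translate_in[OF x(1), of ?p]] ballI)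
  qed
  have "\<pi> x' (i + int s + L + j) = z j" if "j \<in> {-L..L}" for j
  proof -
    have "x' k = x k" if "k \<in> {i + int s + L + j - r..i + int s + L + j + r}" for k
      using unroll[of "k - a"] that \<open>j \<in> {-L..L}\<close> q by (simp add: x'_def a_def)
    then have "\<pi> x' (i + int s + L + j) = \<pi> x (i + int s + L + j)"
      by (rule code_local[OF x'X x(1)])
    then show ?thesis using occ[OF s(1) that] by simp
  qed
  moreover have "\<pi> x' (j + q) = \<pi> x' j" for j
  proof -
    have "(\<lambda>j. x' (j + q)) = x'" using period by blast
    then show ?thesis using fun_cong[OF code_translate[OF x'X, of q], of j] by simp
  qed
  ultimately show ?thesis using that[of "\<pi> x'" q "i + int s + L"] x'X q by blast
qed

text \<open>Shifting by the period \<open>q\<close> of \<open>y\<close> maps the finite fibre into itself, so the shifts of \<open>x\<close> by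
  multiples of \<open>q\<close> cannot all be distinct.\<close>

lemma periodic_in_fibre:
  assumes fin: "finite (fibre X \<pi> y)" and y: "\<And>j. y (j + q) = y j" "0 < q"
    and x: "x \<in> fibre X \<pi> y"
  obtains s :: int where "0 < s" "\<And>j. x (j + s) = x j"
proof -
  have yn: "y (j + int n * q) = y j" for j n
  proof (induction n)
    case (Suc n)
    have "y (j + int (Suc n) * q) = y (j + int n * q + q)" by (simp add: algebra_simps)
    then show ?case using Suc y(1) by simp
  qed simp
  define f where "f n = (\<lambda>j. x (j + int n * q))" for n :: nat
  have "f n \<in> fibre X \<pi> y" for n
    using x yn translate_in code_translate by (auto simp: f_def fibre_def)
  then have "finite (range f)" using fin by (meson finite_subset image_subsetI)
  then have "\<not> inj f" using finite_imageD by blast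
  then obtain m n where mn: "f m = f n" "m < n"
    unfolding inj_on_def by (metis linorder_neqE_nat)
  have "x (j + (int n - int m) * q) = x j" for j
    using fun_cong[OF mn(1), of "j - int m * q"] by (simp add: f_def algebra_simps)
  then show ?thesis using that[of "(int n - int m) * q"] mn(2) y(2) by simp
qed

end

section \<open>The two degrees agree\<close>

context local_code begin

text \<open>At a periodic point through the transition block of \<open>y0\<close>, the map sending a point of the fibre to
  the point of \<open>R\<close> that its detour follows is injective: two points with the same value can be
  joined into one periodic point that has a ray in common with each of them.\<close>

lemma small_fibre:
  assumes irr: "irreducible_shift (\<pi> ` X)" and fin: "\<And>y. finite (fibre X \<pi> y)"
    and y0: "y0 \<in> \<pi> ` X"
  shows "\<exists>y\<in>\<pi> ` X. card (fibre X \<pi> y) \<le> card (transition_classes X \<pi> y0)"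
proof -
  obtain L t T R where L: "0 \<le> L" and t: "0 < t" "t \<le> T" and R: "finite R"
    "card R \<le> card (transition_classes X \<pi> y0)" and
    detour: "\<And>x p. \<lbrakk>x \<in> X; \<And>j. j \<in> {-L..L} \<Longrightarrow> \<pi> x (p + j) = y0 j\<rbrakk> \<Longrightarrow>
       \<exists>\<rho>\<in>R. \<exists>u\<in>X. \<pi> u = \<pi> x \<and> (\<forall>j\<le>p. u j = x j) \<and>
         (\<forall>j\<in>{t-r..<t+r}. u (p + j) = \<rho> j) \<and> (\<forall>j\<ge>p+T. u j = x j)"
    using transition_word[OF fin[of y0]] by blast
  obtain y q p where y: "y \<in> \<pi> ` X" "0 < q" "\<And>j. y (j + q) = y j"
      "\<And>j. j \<in> {-L..L} \<Longrightarrow> y (p + j) = y0 j"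
    using periodic_point_through_block[OF irr y0 L] by blast
  have "\<forall>x\<in>fibre X \<pi> y. \<exists>\<rho>. \<rho> \<in> R \<and> (\<exists>u\<in>fibre X \<pi> y. (\<forall>j\<le>p. u j = x j) \<and>
         (\<forall>j\<in>{t-r..<t+r}. u (p + j) = \<rho> j) \<and> (\<forall>j\<ge>p+T. u j = x j))"
  proof
    fix x assume "x \<in> fibre X \<pi> y"
    then have x: "x \<in> X" "\<pi> x = y" by (auto simp: fibre_def)
    show "\<exists>\<rho>. \<rho> \<in> R \<and> (\<exists>u\<in>fibre X \<pi> y. (\<forall>j\<le>p. u j = x j) \<and>
         (\<forall>j\<in>{t-r..<t+r}. u (p + j) = \<rho> j) \<and> (\<forall>j\<ge>p+T. u j = x j))"
    proof -
      obtain \<rho> u where u: "\<rho> \<in> R" "u \<in> X" "\<pi> u = y" "\<forall>j\<le>p. u j = x j"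
          "\<forall>j\<in>{t-r..<t+r}. u (p + j) = \<rho> j" "\<forall>j\<ge>p+T. u j = x j"
        using detour[OF x(1), of p] x(2) y(4) by auto
      have "u \<in> fibre X \<pi> y" using u(2,3) by (simp add: fibre_def)
      then show ?thesis using u(1,4-6) by (intro exI[of _ \<rho>] conjI bexI[of _ u])
    qed
  qed
  from bchoice[OF this] obtain g where g: "\<And>x. x \<in> fibre X \<pi> y \<Longrightarrow> g x \<in> R"
    "\<And>x. x \<in> fibre X \<pi> y \<Longrightarrow> \<exists>u\<in>fibre X \<pi> y. (\<forall>j\<le>p. u j = x j) \<and>
         (\<forall>j\<in>{t-r..<t+r}. u (p + j) = g x j) \<and> (\<forall>j\<ge>p+T. u j = x j)"
    by blast
  have "inj_on g (fibre X \<pi> y)"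
  proof (rule inj_onI)
    fix x x' assume x: "x \<in> fibre X \<pi> y" "x' \<in> fibre X \<pi> y" "g x = g x'"
    obtain u where u: "u \<in> fibre X \<pi> y" "\<forall>j\<le>p. u j = x j" "\<forall>j\<in>{t-r..<t+r}. u (p + j) = g x j"
      using g(2)[OF x(1)] by blast
    obtain u' where u': "u' \<in> fibre X \<pi> y" "\<forall>j\<in>{t-r..<t+r}. u' (p + j) = g x j"
        "\<forall>j\<ge>p+T. u' j = x' j"
      using g(2)[OF x(2)] x(3) by metis
    let ?v = "splice (p + t) u u'"
    have X: "u \<in> X" "u' \<in> X" "\<pi> u = y" "\<pi> u' = y" using u(1) u'(1) by (auto simp: fibre_def)
    have agree: "u j = u' j" if "j \<in> {p + t - r..<p + t + r}" for j
    proof -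
      have "j - p \<in> {t-r..<t+r}" using that by auto
      then show ?thesis using u(3) u'(2) by (metis add.commute diff_add_cancel)
    qed
    have v: "?v \<in> fibre X \<pi> y"
      using splice_in[OF X(1,2) agree] code_splice[OF X(1,2) agree] X(3,4)
      by (auto simp: fibre_def splice_def)
    obtain a where a: "0 < a" "\<And>j. x (j + a) = x j"
      using periodic_in_fibre[OF fin y(3,2) x(1)] by blast
    obtain b where b: "0 < b" "\<And>j. x' (j + b) = x' j"
      using periodic_in_fibre[OF fin y(3,2) x(2)] by blast
    obtain c where c: "0 < c" "\<And>j. ?v (j + c) = ?v j"
      using periodic_in_fibre[OF fin y(3,2) v] by blast
    have "\<forall>j\<le>p. ?v j = x j" using u(2) t by (auto simp: splice_def)
    then have "?v = x" using periodic_eq_if_agree_on_ray[of ?v c x a] c a by blast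
    moreover have "\<forall>j\<ge>p+T. ?v j = x' j" using u'(3) t by (auto simp: splice_def)
    then have "?v = x'" using periodic_eq_if_agree_on_ray[of ?v c x' b] c b by blast
    ultimately show "x = x'" by simp
  qed
  then have "card (fibre X \<pi> y) \<le> card R" using g(1) R(1) by (intro card_inj_on_le) auto
  then show ?thesis using R(2) y(1) by (meson order_trans)
qed

end

theorem theorem4p24:
  fixes A :: "'a set" and B :: "'b set"
    and X :: "(int \<Rightarrow> 'a) set" and Y :: "(int \<Rightarrow> 'b) set"
    and \<pi> :: "(int \<Rightarrow> 'a) \<Rightarrow> (int \<Rightarrow> 'b)"
  assumes "shift_of_finite_type A X"
    and "sofic_shift B Y"
    and "irreducible_shift Y"
    and "factor_code A X B Y \<pi>"
    and "finite_to_one X Y \<pi>"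
  shows "class_degree X Y \<pi> = code_degree X Y \<pi>"
proof -
  obtain r where "local_code A X \<pi> r" using local_code_exists assms(1,4) by blast
  then interpret local_code A X \<pi> r .
  have Y: "\<pi> ` X = Y" using assms(4) by (simp add: factor_code_def)
  have fin: "finite (fibre X \<pi> y)" for y
  proof (cases "y \<in> Y")
    case False
    then have "fibre X \<pi> y = {}" using Y by (auto simp: fibre_def)
    then show ?thesis by simp
  qed (use assms(5) in \<open>simp add: finite_to_one_def\<close>)
  have ecards: "ecard (fibre X \<pi> y) = enat (card (fibre X \<pi> y))"
    "ecard (transition_classes X \<pi> y) = enat (card (transition_classes X \<pi> y))" for y
    using fin by (simp_all add: ecard_def transition_classes_eq_image)
  show ?thesis unfolding class_degree_def code_degree_def
  proof (rule antisym)
    show "(INF y\<in>Y. ecard (transition_classes X \<pi> y)) \<le> (INF y\<in>Y. ecard (fibre X \<pi> y))"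
    proof (rule INF_mono)
      fix y assume "y \<in> Y"
      moreover have "card (transition_classes X \<pi> y) \<le> card (fibre X \<pi> y)"
        using fin unfolding transition_classes_eq_image by (rule card_image_le)
      ultimately show "\<exists>y'\<in>Y. ecard (transition_classes X \<pi> y') \<le> ecard (fibre X \<pi> y)"
        unfolding ecards by (intro bexI[of _ y]) simp
    qed
    show "(INF y\<in>Y. ecard (fibre X \<pi> y)) \<le> (INF y\<in>Y. ecard (transition_classes X \<pi> y))"
      using small_fibre[OF _ fin] assms(3) unfolding Y
      by (intro INF_mono) (simp add: ecards)
  qed
qed

end
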